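(* $$\sum_{k=0}^\infty\frac{1}{(1+k)^3}\;{}_1\Psi_1\left[\begin{array}{c}(3,2)\\(\tfrac32,1)\end{array}\Big|\,-\frac{n^2}{16(1+k)^2}\right]=\frac{2i}{\sqrt{\pi}\,n}\left\{\psi'\left(1+\tfrac12 in\right)-\psi'\left(1-\tfrac12 in\right)\right\},$$ where $n$ is free to be chosen.
   Context: Here $i=\sqrt{-1}$, $\psi(z)=\Gamma'(z)/\Gamma(z)$ is the logarithmic derivative of $\Gamma(z)$ and the prime on $\psi$ denotes differentiation. ${}_1\Psi_1$ is the Fox–Wright function, defined by the series $${}_1\Psi_1\left[\begin{array}{c}(\alpha,A)\\(\beta,B)\end{array}\Big|\,z\right]=\sum_{\ell=0}^\infty\frac{\Gamma(\alpha+\ell A)}{\Gamma(\beta+\ell B)}\,\frac{z^\ell}{\ell!},$$ where $z,\alpha,\beta\in\mathbb{C}$ and $A,B\ge0$, it being supposed that the parameters are such that the gamma functions are well defined. In particular ${}_1\Psi_1\left[\begin{array}{c}(3,2)\\(\frac32,1)\end{array}\Big|\,z\right]=\sum_{\ell=0}^\infty\frac{\Gamma(3+2\ell)}{\Gamma(\frac32+\ell)}\frac{z^\ell}{\ell!}$.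
   Formalization: For |n| ≥ 2 some of the series defining ₁Ψ₁ diverge (e.g. n=3, k=0), so there ₁Ψ₁ is read as the analytic continuation of its series; n is any complex number with n ≠ 0 and 1 ± in/2 not a pole of ψ'. *)

theory Defs
  imports "HOL-Complex_Analysis.Complex_Analysis"
begin

definition fox_wright_term :: "complex \<Rightarrow> real \<Rightarrow> complex \<Rightarrow> real \<Rightarrow> complex \<Rightarrow> nat \<Rightarrow> complex" where
  "fox_wright_term \<alpha> A \<beta> B z l =
     Gamma (\<alpha> + of_nat l * of_real A) / Gamma (\<beta> + of_nat l * of_real B) * z ^ l / fact l"

definition fox_wright_continuation ::
    "complex \<Rightarrow> real \<Rightarrow> complex \<Rightarrow> real \<Rightarrow> complex \<Rightarrow> complex \<Rightarrow> bool" where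
  "fox_wright_continuation \<alpha> A \<beta> B z w \<longleftrightarrow>
     (\<exists>S F r. open S \<and> connected S \<and> z \<in> S \<and> F holomorphic_on S \<and> F z = w \<and>
        r > 0 \<and> ball 0 r \<subseteq> S \<and>
        (\<forall>u \<in> ball 0 r. fox_wright_term \<alpha> A \<beta> B u sums F u))"

text \<open>
  The function is the sum of the defining series wherever that series converges. If
  \<open>A = B + 1\<close> the radius of convergence is finite (it is \<open>1/4\<close> for \<open>A = 2\<close>, \<open>B = 1\<close>); where
  the series diverges the symbol denotes the analytic continuation of the series, provided that
  this does not depend on the domain chosen. Otherwise the value is unspecified.
\<close>

definition fox_wright :: "complex \<Rightarrow> real \<Rightarrow> complex \<Rightarrow> real \<Rightarrow> complex \<Rightarrow> complex" where
  "fox_wright \<alpha> A \<beta> B z =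
     (if summable (fox_wright_term \<alpha> A \<beta> B z) then (\<Sum>l. fox_wright_term \<alpha> A \<beta> B z l)
      else (THE w. fox_wright_continuation \<alpha> A \<beta> B z w))"

end

theory Submission imports Defs
begin

text \<open>
  Legendre's duplication formula turns the series of the Fox--Wright function into
  \<open>(4/\<surd>\<pi>) \<Sum> (l+1) (4z)^l\<close>, the derivative of a geometric series. The function is therefore the
  rational function \<open>(4/\<surd>\<pi>) / (1 - 4z)\<^sup>2\<close>, both inside the disc of convergence and, by analytic
  continuation, everywhere except at \<open>z = 1/4\<close> (\<open>fox_wright_eval\<close>).

  With \<open>m = k + 1\<close>, the summand on the left becomes \<open>(4/\<surd>\<pi>) m / (m\<^sup>2 + (n/2)\<^sup>2)\<^sup>2\<close>. Its partial
  fraction decomposition is a multiple of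
  \<open>1/(m + \<i>n/2)\<^sup>2 - 1/(m - \<i>n/2)\<^sup>2\<close>, and \<open>\<Sum> 1/(m + w)\<^sup>2\<close> over \<open>m \<ge> 1\<close> is the classical expansion
  of \<open>\<psi>'(1 + w)\<close>. The two hypotheses on \<open>1 \<plusminus> \<i>n/2\<close> say that no \<open>m\<^sup>2 + (n/2)\<^sup>2\<close> vanishes, that is,
  that no argument of the Fox--Wright function hits the pole \<open>1/4\<close>.
\<close>

lemma fox_wright_term_eq:
  "fox_wright_term 3 2 (3/2) 1 z l =
     4 / of_real (sqrt pi) * (of_nat (Suc l) * (4 * z) ^ l)"
proof -
  define s :: complex where "s = of_nat l + 3/2"
  have s: "s = of_real (real l + 3/2)" by (simp add: s_def)
  \<comment> \<open>Duplication at \<open>s\<close> relates \<open>\<Gamma>(2s)\<close>, the numerator, to \<open>\<Gamma>(s)\<close>, the denominator, and leaves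
    the factorial \<open>\<Gamma>(s + 1/2) = (l+1)!\<close>.\<close>
  have "s + 1/2 = of_nat (Suc (Suc l))" by (simp add: s_def)
  hence s1: "Gamma (s + 1/2) = fact (Suc l)"
    by (metis Gamma_fact of_nat_Suc)
  have nz: "Gamma s \<noteq> 0"
    unfolding s Gamma_complex_of_real of_real_eq_0_iff
    using Gamma_real_pos[of "real l + 3/2"] by (simp add: less_imp_neq[symmetric])
  have notin: "s \<notin> \<int>\<^sub>\<le>\<^sub>0" "s + 1/2 \<notin> \<int>\<^sub>\<le>\<^sub>0"
    unfolding s by (auto elim!: nonpos_Ints_cases simp: complex_eq_iff)
  have e: "(1 - 2 * s) * of_real (ln 2) = of_real (- (real (2 * l + 2) * ln 2))"
    by (simp add: s_def algebra_simps)
  have "exp ((1 - 2 * s) * of_real (ln 2)) = (inverse (2 ^ (2 * l + 2)) :: complex)"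
    unfolding e exp_of_real exp_minus exp_of_nat_mult by simp
  with Gamma_legendre_duplication[OF notin] s1
  have dup: "Gamma s * fact (Suc l) = inverse (2 ^ (2 * l + 2)) * of_real (sqrt pi) * Gamma (2 * s)"
    by simp
  have pi0: "(of_real (sqrt pi) :: complex) \<noteq> 0" by simp
  have "(2::complex) ^ (2 * l + 2) = 4 * 4 ^ l"
    by (simp add: power_add power_mult)
  with dup pi0 have "Gamma (2 * s) = 4 * 4 ^ l / of_real (sqrt pi) * Gamma s * fact (Suc l)"
    by (simp add: field_simps)
  moreover have "2 * s = 3 + of_nat l * of_real 2" "s = 3/2 + of_nat l * of_real 1"
    by (simp_all add: s_def)
  ultimately have "fox_wright_term 3 2 (3/2) 1 z l =
      (4 * 4 ^ l / of_real (sqrt pi) * Gamma s * fact (Suc l)) / Gamma s * z ^ l / fact l"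
    unfolding fox_wright_term_def by metis
  also have "\<dots> = 4 / of_real (sqrt pi) * (of_nat (Suc l) * (4 * z) ^ l)"
    using nz pi0 by (simp add: field_simps power_mult_distrib)
  finally show ?thesis .
qed

lemma fox_wright_term_sums:
  assumes "norm (4 * z) < 1"
  shows "fox_wright_term 3 2 (3/2) 1 z sums (4 / of_real (sqrt pi) / (1 - 4 * z)\<^sup>2)"
proof -
  have "(\<lambda>l. of_nat (Suc l) * (4 * z) ^ l) sums (1 / (1 - 4 * z)\<^sup>2)"
    using geometric_deriv_sums[OF assms] by simp
  from sums_mult[OF this, of "4 / of_real (sqrt pi)"] show ?thesis
    unfolding fox_wright_term_eq by simp
qed

text \<open>
  The factor \<open>l + 1\<close> keeps the terms away from \<open>0\<close> even on the circle \<open>\<bar>z\<bar> = 1/4\<close>, so the dichotomy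
  between convergence and continuation leaves no boundary case.
\<close>

lemma fox_wright_term_not_summable:
  assumes "norm (4 * z) \<ge> 1"
  shows "\<not> summable (fox_wright_term 3 2 (3/2) 1 z)"
proof
  assume "summable (fox_wright_term 3 2 (3/2) 1 z)"
  hence "(\<lambda>l. norm (fox_wright_term 3 2 (3/2) 1 z l)) \<longlonglongrightarrow> 0"
    by (intro tendsto_norm_zero summable_LIMSEQ_zero)
  moreover have "norm (fox_wright_term 3 2 (3/2) 1 z l) \<ge> 4 / sqrt pi" for l
  proof -
    have "1 * 1 \<le> real (Suc l) * norm (4 * z) ^ l"
      using assms by (intro mult_mono one_le_power) auto
    hence "4 / sqrt pi * 1 \<le> 4 / sqrt pi * (real (Suc l) * norm (4 * z) ^ l)"
      by (intro mult_left_mono) auto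
    also have "\<dots> = norm (fox_wright_term 3 2 (3/2) 1 z l)"
      unfolding fox_wright_term_eq norm_mult norm_divide norm_power norm_of_nat norm_of_real
      by simp
    finally show ?thesis by simp
  qed
  ultimately have "4 / sqrt pi \<le> 0"
    by (intro tendsto_lowerbound[where F = sequentially]) auto
  thus False using pi_gt_zero by (simp add: divide_le_0_iff)
qed

text \<open>
  A domain of continuation may contain the point \<open>1/4\<close>, where the rational function has its pole,
  so the identity theorem is applied to the product \<open>(1 - 4u)\<^sup>2 F(u)\<close>: it is constant near the
  origin, hence on the whole domain.
\<close>

lemma fox_wright_continuation_unique:
  assumes "fox_wright_continuation 3 2 (3/2) 1 z w" and "z \<noteq> 1/4"
  shows "w = 4 / of_real (sqrt pi) / (1 - 4 * z)\<^sup>2"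
proof -
  from assms(1) obtain S F r where S: "open S" "connected S" "z \<in> S" "F holomorphic_on S"
      "F z = w" "r > 0" "ball 0 r \<subseteq> S"
      and F: "\<And>u. u \<in> ball 0 r \<Longrightarrow> fox_wright_term 3 2 (3/2) 1 u sums F u"
    unfolding fox_wright_continuation_def by blast
  define U where "U = ball (0::complex) (min r (1/4))"
  define g where "g = (\<lambda>u. (1 - 4 * u)\<^sup>2 * F u - 4 / of_real (sqrt pi))"
  have g0: "g u = 0" if "u \<in> U" for u
  proof -
    have u: "norm (4 * u) < 1" "u \<in> ball 0 r" using that by (auto simp: U_def norm_mult)
    have "F u = 4 / of_real (sqrt pi) / (1 - 4 * u)\<^sup>2"
      using sums_unique2[OF F[OF u(2)] fox_wright_term_sums[OF u(1)]] .
    moreover have "1 - 4 * u \<noteq> 0" using u(1) by (metis eq_iff_diff_eq_0 norm_one order.irrefl)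
    ultimately show ?thesis by (simp add: g_def)
  qed
  have "g holomorphic_on S" unfolding g_def by (intro holomorphic_intros S(4))
  moreover have "U \<subseteq> S" using S(7) by (auto simp: U_def)
  moreover have "0 \<in> U" "open U" using S(6) by (auto simp: U_def)
  ultimately have "g z = 0"
    using analytic_continuation_open[of U S g "\<lambda>_. 0" z] S(1-3) g0 by auto
  moreover have "1 - 4 * z \<noteq> 0" using assms(2) by (auto simp: field_simps)
  ultimately show ?thesis using S(5) by (simp add: g_def field_simps)
qed

lemma fox_wright_continuation_exists:
  assumes "z \<noteq> 1/4"
  shows "fox_wright_continuation 3 2 (3/2) 1 z (4 / of_real (sqrt pi) / (1 - 4 * z)\<^sup>2)"
  unfolding fox_wright_continuation_def
proof (intro exI conjI ballI)
  show "open (- {1/4 :: complex})" by auto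
  show "connected (- {1/4 :: complex})" by (rule connected_punctured_universe) simp
  show "z \<in> - {1/4}" using assms by simp
  show "(\<lambda>u. 4 / of_real (sqrt pi) / (1 - 4 * u)\<^sup>2) holomorphic_on - {1/4}"
    by (auto intro!: holomorphic_intros simp: field_simps)
  show "(0::real) < 1/4" by simp
  show "ball 0 (1/4) \<subseteq> - {1/4 :: complex}" by (auto simp: norm_divide)
  show "fox_wright_term 3 2 (3/2) 1 u sums (4 / of_real (sqrt pi) / (1 - 4 * u)\<^sup>2)"
    if "u \<in> ball 0 (1/4)" for u
    using that by (intro fox_wright_term_sums) (simp add: norm_mult)
qed simp

lemma fox_wright_eval:
  assumes "z \<noteq> 1/4"
  shows "fox_wright 3 2 (3/2) 1 z = 4 / of_real (sqrt pi) / (1 - 4 * z)\<^sup>2"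
proof (cases "norm (4 * z) < 1")
  case True
  from fox_wright_term_sums[OF this] show ?thesis
    unfolding fox_wright_def by (simp add: sums_iff)
next
  case False
  hence "\<not> summable (fox_wright_term 3 2 (3/2) 1 z)"
    by (intro fox_wright_term_not_summable) simp
  moreover have "(THE w. fox_wright_continuation 3 2 (3/2) 1 z w) =
      4 / of_real (sqrt pi) / (1 - 4 * z)\<^sup>2"
    using fox_wright_continuation_exists[OF assms] fox_wright_continuation_unique[OF _ assms]
    by (intro the_equality)
  ultimately show ?thesis by (simp add: fox_wright_def)
qed

lemma deriv_Digamma_sums:
  fixes z :: complex
  assumes "z \<notin> \<int>\<^sub>\<le>\<^sub>0"
  shows "(\<lambda>k. 1 / (z + of_nat k)\<^sup>2) sums deriv Digamma z"
proof -
  have "deriv Digamma z = Polygamma 1 z"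
    using has_field_derivative_Polygamma[of z 0] assms by (intro DERIV_imp_deriv) simp
  thus ?thesis
    using Polygamma_LIMSEQ[of z 1] assms
    by (auto simp: power2_eq_square divide_inverse dest: plus_of_nat_eq_0_imp)
qed

theorem mainTheorem4:
  fixes n :: complex
  assumes "n \<noteq> 0"
    and "1 + \<i> * n / 2 \<notin> \<int>\<^sub>\<le>\<^sub>0"
    and "1 - \<i> * n / 2 \<notin> \<int>\<^sub>\<le>\<^sub>0"
  shows "(\<lambda>k::nat. 1 / (1 + of_nat k) ^ 3 *
            fox_wright 3 2 (3 / 2) 1 (- n\<^sup>2 / (16 * (1 + of_nat k)\<^sup>2)))
         sums
         (2 * \<i> / (of_real (sqrt pi) * n) *
            (deriv Digamma (1 + \<i> * n / 2) - deriv Digamma (1 - \<i> * n / 2)))"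
proof -
  have "(\<lambda>k. 2 * \<i> / (of_real (sqrt pi) * n) *
            (1 / (1 + \<i> * n / 2 + of_nat k)\<^sup>2 - 1 / (1 - \<i> * n / 2 + of_nat k)\<^sup>2))
        sums (2 * \<i> / (of_real (sqrt pi) * n) *
            (deriv Digamma (1 + \<i> * n / 2) - deriv Digamma (1 - \<i> * n / 2)))"
    by (intro sums_mult sums_diff deriv_Digamma_sums assms)
  moreover have "2 * \<i> / (of_real (sqrt pi) * n) *
            (1 / (1 + \<i> * n / 2 + of_nat k)\<^sup>2 - 1 / (1 - \<i> * n / 2 + of_nat k)\<^sup>2) =
         1 / (1 + of_nat k) ^ 3 *
            fox_wright 3 2 (3 / 2) 1 (- n\<^sup>2 / (16 * (1 + of_nat k)\<^sup>2))" for k :: nat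
  proof -
    define m :: complex where "m = 1 + of_nat k"
    define a where "a = \<i> * n / 2"
    define p where "p = m + a"
    define q where "q = m - a"
    have m0: "m \<noteq> 0" unfolding m_def by (metis of_nat_Suc of_nat_eq_0_iff nat.distinct(1))
    have a0: "a \<noteq> 0" using assms(1) by (simp add: a_def)
    have n: "n = - 2 * \<i> * a" by (simp add: a_def)
    have p: "1 + \<i> * n / 2 + of_nat k = p" and q: "1 - \<i> * n / 2 + of_nat k = q"
      by (simp_all add: p_def q_def m_def a_def)
    have p0: "p \<noteq> 0" using assms(2) plus_of_nat_eq_0_imp[of "1 + \<i> * n / 2" k] p by auto
    have q0: "q \<noteq> 0" using assms(3) plus_of_nat_eq_0_imp[of "1 - \<i> * n / 2" k] q by auto
    have pq: "p * q = m\<^sup>2 - a\<^sup>2" by (simp add: p_def q_def algebra_simps power2_eq_square)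
    define z where "z = - n\<^sup>2 / (16 * m\<^sup>2)"
    have eq: "1 - 4 * z = p * q / m\<^sup>2"
      unfolding pq z_def n using m0 by (simp add: field_simps)
    hence "1 - 4 * z \<noteq> 0" using p0 q0 m0 by simp
    hence "z \<noteq> 1/4" by force
    hence fw: "fox_wright 3 2 (3/2) 1 z = 4 / of_real (sqrt pi) * m ^ 4 / (p * q)\<^sup>2"
      by (simp add: fox_wright_eval eq power_divide flip: power_mult)
    have "1 / p\<^sup>2 - 1 / q\<^sup>2 = (q\<^sup>2 - p\<^sup>2) / (p * q)\<^sup>2"
      using p0 q0 by (simp add: field_simps)
    also have "q\<^sup>2 - p\<^sup>2 = - 4 * m * a"
      by (simp add: p_def q_def power2_eq_square algebra_simps)
    finally have "2 * \<i> / (of_real (sqrt pi) * n) * (1 / p\<^sup>2 - 1 / q\<^sup>2) =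
        4 / of_real (sqrt pi) * m / (p * q)\<^sup>2"
      using a0 by (simp add: n field_simps)
    also have "\<dots> = 1 / m ^ 3 * (4 / of_real (sqrt pi) * m ^ 4 / (p * q)\<^sup>2)"
      using m0 by (simp add: power3_eq_cube power4_eq_xxxx)
    finally show ?thesis by (simp only: p q fw flip: m_def z_def)
  qed
  ultimately show ?thesis by simp
qed

end
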